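(* Every free group acts with property P (thus with unique visits, thus without $A$-cancellation for all finite abelian groups $A$) by automorphisms on a full shift $\Sigma^{\mathbb{Z}}$, for some finite alphabet $\Sigma$.
   Context: For a finite alphabet $\Sigma$ with $|\Sigma|\ge 2$, $\mathrm{Aut}(\Sigma^{\mathbb{Z}})$ is the group of homeomorphisms of the full shift $\Sigma^{\mathbb{Z}}$ commuting with the shift $\sigma(x)_i = x_{i+1}$. An action by automorphisms on $\Sigma^{\mathbb{Z}}$ is an action through a homomorphism into $\mathrm{Aut}(\Sigma^{\mathbb{Z}})$. For a nonempty word $w$, $w^{\mathbb{Z}}\in\Sigma^{\mathbb{Z}}$ is the configuration $x$ with $x_i = w_j$ where $0\le j<|w|$, $j\equiv i \bmod |w|$. Property P: a subgroup $G\le\mathrm{Aut}(\Sigma^{\mathbb{Z}})$ has property P if for each nonempty finite $F\subset G$ there exist $g\in F$, words $u,v\in\Sigma^*$ with $|u|=|v|$ (possibly empty), and letters $a,b,a',b'\in\Sigma$ such that $g((uabv)^{\mathbb{Z}})|_{\{-1,0\}}\neq g((ua'b'v)^{\mathbb{Z}})|_{\{-1,0\}}$ and, for all $h\in F\setminus\{g\}$, $h((uabv)^{\mathbb{Z}})|_{\{-1,0\}} = h((ua'b'v)^{\mathbb{Z}})|_{\{-1,0\}}$. A group acts with property P by automorphisms on $\Sigma^{\mathbb{Z}}$ if it acts faithfully by automorphisms on $\Sigma^{\mathbb{Z}}$ and its image in $\mathrm{Aut}(\Sigma^{\mathbb{Z}})$ has property P. A $G$-system $(G,X)$ is a zero-dimensional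 compact metrizable space $X$ with an action of the discrete group $G$ by homeomorphisms. It has unique visits if there is a clopen set $C\subset X$ such that for every nonempty finite $F\subset G$ there exists $x\in X$ such that there is exactly one $g\in F$ with $gx\in C$. Let $A$, $B$ be finite abelian groups and $\theta : X \to \mathrm{Hom}(A,B)$ continuous ($\mathrm{Hom}(A,B)$ discrete). $(G,X)$ has $A$-cancellation with respect to $(\theta,B)$ if there exists a finitely supported map $f : G\to A$, $f\neq 0$, such that $\sum_{g\in G}\theta(gx)(f(g)) = 0$ for all $x\in X$. $(G,X)$ has $A$-cancellation if it has $A$-cancellation with respect to every such $(\theta,B)$ (for all finite abelian $B$); otherwise it is without $A$-cancellation.
   Formalization: The free group is assumed countable: Aut(Σ^ℤ) is countable, so an uncountable free group has no faithful action by automorphisms and the claim fails for it. Finite abelian groups A are taken with elements among the natural numbers, which covers all up to isomorphism. *)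

theory Defs
  imports "HOL-Analysis.Analysis" "HOL-Algebra.Group_Action" "HOL-Algebra.FiniteProduct"
begin

section \<open>Free groups\<close>

text \<open>A word over \<open>S\<close> and its formal inverses is a list of letters \<open>(s, e)\<close>, where
  \<open>(s, True)\<close> stands for \<open>s\<close> and \<open>(s, False)\<close> for its inverse.\<close>

definition reduced_words :: "'g set \<Rightarrow> ('g \<times> bool) list set" where
  "reduced_words S =
    {w. set w \<subseteq> S \<times> UNIV \<and> successively (\<lambda>(s, d) (t, e). \<not> (s = t \<and> d \<noteq> e)) w}"

definition word_value :: "('g, 'm) monoid_scheme \<Rightarrow> ('g \<times> bool) list \<Rightarrow> 'g" where
  "word_value G w =
    foldr (\<lambda>(s, e) y. (if e then s else inv\<^bsub>G\<^esub> s) \<otimes>\<^bsub>G\<^esub> y) w \<one>\<^bsub>G\<^esub>"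

text \<open>\<open>G\<close> is free on \<open>S\<close> if every element is the value of exactly one reduced word.
  The set \<open>S\<close> may be empty, finite or infinite.\<close>

definition free_basis :: "('g, 'm) monoid_scheme \<Rightarrow> 'g set \<Rightarrow> bool" where
  "free_basis G S \<longleftrightarrow>
    S \<subseteq> carrier G \<and> bij_betw (word_value G) (reduced_words S) (carrier G)"

definition free_group :: "('g, 'm) monoid_scheme \<Rightarrow> bool" where
  "free_group G \<longleftrightarrow> group G \<and> (\<exists>S. free_basis G S)"


section \<open>Full shifts and their automorphism groups\<close>

type_synonym 'a config = "int \<Rightarrow> 'a"

text \<open>The underlying set of this topology is the set of all maps from the integers to \<open>\<Sigma>\<close>.\<close>

definition full_shift :: "'a set \<Rightarrow> 'a config topology" where
  "full_shift \<Sigma> = product_topology (\<lambda>_. discrete_topology \<Sigma>) UNIV"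

definition shift :: "'a config \<Rightarrow> 'a config" where
  "shift x = (\<lambda>i. x (i + 1))"

text \<open>As in \<^const>\<open>BijGroup\<close>, elements are extensional on the set of configurations and
  multiplication is composition.\<close>

definition Aut_shift :: "'a set \<Rightarrow> ('a config \<Rightarrow> 'a config) monoid" where
  "Aut_shift \<Sigma> = BijGroup (topspace (full_shift \<Sigma>))
    \<lparr>carrier := {g \<in> Bij (topspace (full_shift \<Sigma>)).
       homeomorphic_map (full_shift \<Sigma>) (full_shift \<Sigma>) g \<and>
       (\<forall>x \<in> topspace (full_shift \<Sigma>). g (shift x) = shift (g x))}\<rparr>"

definition periodic :: "'a list \<Rightarrow> 'a config" where
  "periodic w = (\<lambda>i. w ! nat (i mod int (length w)))"


section \<open>Property P\<close>

definition property_P :: "'a set \<Rightarrow> ('a config \<Rightarrow> 'a config) set \<Rightarrow> bool" where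
  "property_P \<Sigma> H \<longleftrightarrow>
    (\<forall>F. finite F \<and> F \<noteq> {} \<and> F \<subseteq> H \<longrightarrow>
      (\<exists>g \<in> F. \<exists>u \<in> lists \<Sigma>. \<exists>v \<in> lists \<Sigma>. \<exists>a \<in> \<Sigma>. \<exists>b \<in> \<Sigma>. \<exists>a' \<in> \<Sigma>. \<exists>b' \<in> \<Sigma>.
        length u = length v \<and>
        restrict (g (periodic (u @ [a, b] @ v))) {-1, 0}
          \<noteq> restrict (g (periodic (u @ [a', b'] @ v))) {-1, 0} \<and>
        (\<forall>h \<in> F - {g}.
          restrict (h (periodic (u @ [a, b] @ v))) {-1, 0}
            = restrict (h (periodic (u @ [a', b'] @ v))) {-1, 0})))"

definition acts_with_property_P ::
  "('g, 'm) monoid_scheme \<Rightarrow> 'a set \<Rightarrow> ('g \<Rightarrow> 'a config \<Rightarrow> 'a config) \<Rightarrow> bool" where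
  "acts_with_property_P G \<Sigma> \<phi> \<longleftrightarrow>
    \<phi> \<in> hom G (Aut_shift \<Sigma>) \<and> inj_on \<phi> (carrier G) \<and> property_P \<Sigma> (\<phi> ` carrier G)"


section \<open>Unique visits and cancellation\<close>

definition G_system ::
  "('g, 'm) monoid_scheme \<Rightarrow> 'x topology \<Rightarrow> ('g \<Rightarrow> 'x \<Rightarrow> 'x) \<Rightarrow> bool" where
  "G_system G X \<phi> \<longleftrightarrow>
    compact_space X \<and> metrizable_space X \<and> X dim_le 0 \<and>
    group_action G (topspace X) \<phi> \<and>
    (\<forall>g \<in> carrier G. homeomorphic_map X X (\<phi> g))"

definition unique_visits ::
  "('g, 'm) monoid_scheme \<Rightarrow> 'x topology \<Rightarrow> ('g \<Rightarrow> 'x \<Rightarrow> 'x) \<Rightarrow> bool" where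
  "unique_visits G X \<phi> \<longleftrightarrow>
    (\<exists>C. openin X C \<and> closedin X C \<and>
      (\<forall>F. finite F \<and> F \<noteq> {} \<and> F \<subseteq> carrier G \<longrightarrow>
        (\<exists>x \<in> topspace X. \<exists>!g. g \<in> F \<and> \<phi> g x \<in> C)))"

text \<open>Abelian groups are written multiplicatively, following \<^const>\<open>finprod\<close>.  Homomorphisms
  are taken extensional, so that each one is represented by exactly one function.\<close>

definition Hom_set :: "('a, 'm) monoid_scheme \<Rightarrow> ('b, 'n) monoid_scheme \<Rightarrow> ('a \<Rightarrow> 'b) set" where
  "Hom_set A B = hom A B \<inter> extensional (carrier A)"

text \<open>\<^const>\<open>finprod\<close> over an infinite set is the neutral element by convention, hence the
  product is taken over the (finite) support of \<open>f\<close>.\<close>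

definition has_cancellation_wrt ::
  "('g, 'm) monoid_scheme \<Rightarrow> 'x topology \<Rightarrow> ('g \<Rightarrow> 'x \<Rightarrow> 'x) \<Rightarrow>
   ('a, 'k) monoid_scheme \<Rightarrow> ('x \<Rightarrow> 'a \<Rightarrow> 'b) \<Rightarrow> ('b, 'l) monoid_scheme \<Rightarrow> bool" where
  "has_cancellation_wrt G X \<phi> A \<theta> B \<longleftrightarrow>
    (\<exists>f \<in> carrier G \<rightarrow> carrier A.
      finite {g \<in> carrier G. f g \<noteq> \<one>\<^bsub>A\<^esub>} \<and>
      (\<exists>g \<in> carrier G. f g \<noteq> \<one>\<^bsub>A\<^esub>) \<and>
      (\<forall>x \<in> topspace X.
        finprod B (\<lambda>g. \<theta> (\<phi> g x) (f g)) {g \<in> carrier G. f g \<noteq> \<one>\<^bsub>A\<^esub>} = \<one>\<^bsub>B\<^esub>))"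

text \<open>Up to isomorphism every finite group has its elements among the natural numbers, so
  letting \<open>B\<close> range over groups on \<^typ>\<open>nat\<close> covers all finite abelian groups.\<close>

definition has_cancellation ::
  "('g, 'm) monoid_scheme \<Rightarrow> 'x topology \<Rightarrow> ('g \<Rightarrow> 'x \<Rightarrow> 'x) \<Rightarrow>
   ('a, 'k) monoid_scheme \<Rightarrow> bool" where
  "has_cancellation G X \<phi> A \<longleftrightarrow>
    (\<forall>(B :: nat monoid) \<theta>.
      comm_group B \<and> finite (carrier B) \<and>
      continuous_map X (discrete_topology (Hom_set A B)) \<theta> \<longrightarrow>
      has_cancellation_wrt G X \<phi> A \<theta> B)"

end

theory Submission
  imports Defs
begin

text \<open>Let four involutions of a full shift move bits along edges between neighbouring cells, the
  edges being labelled by the involutions in a layer which the involutions fix.  A word \<open>w\<close>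
  without equal adjacent letters, written as labels on a row of \<open>|w|\<close> edges, carries the bit at the
  end of the row to its beginning, while no other word of length at most \<open>|w|\<close> does.
  Hence in any finite set of words the longest ones are told apart from all others by a single bit.
  The four involutions generate \<open>\<int>/2 * \<int>/2 * \<int>/2 * \<int>/2\<close>, which contains a free group of
  countably infinite rank.\<close>

section \<open>Words in a free basis\<close>

lemma word_value_Nil [simp]: "word_value G [] = \<one>\<^bsub>G\<^esub>"
  by (simp add: word_value_def)

lemma word_value_Cons:
  "word_value G (l # w) = (if snd l then fst l else inv\<^bsub>G\<^esub> fst l) \<otimes>\<^bsub>G\<^esub> word_value G w"
  by (simp add: word_value_def case_prod_beta)

lemma word_value_closed:
  assumes "group G" "S \<subseteq> carrier G" "set w \<subseteq> S \<times> UNIV"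
  shows "word_value G w \<in> carrier G"
proof -
  interpret group G by fact
  show ?thesis using assms(2,3)
    by (induction w) (auto simp: word_value_Cons)
qed

lemma word_value_append:
  assumes "group G" "S \<subseteq> carrier G" "set v \<subseteq> S \<times> UNIV" "set w \<subseteq> S \<times> UNIV"
  shows "word_value G (v @ w) = word_value G v \<otimes>\<^bsub>G\<^esub> word_value G w"
proof -
  interpret group G by fact
  show ?thesis using assms(3)
  proof (induction v)
    case Nil
    then show ?case using word_value_closed[OF assms(1,2,4)] by simp
  next
    case (Cons l v)
    have "(if snd l then fst l else inv\<^bsub>G\<^esub> fst l) \<in> carrier G"
      using Cons.prems assms(2) by auto
    moreover have "word_value G v \<in> carrier G" "word_value G w \<in> carrier G"
      using Cons.prems word_value_closed[OF assms(1,2)] assms(4) by auto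
    ultimately show ?case
      using Cons by (simp only: append_Cons word_value_Cons) (simp add: m_assoc)
  qed
qed

text \<open>Prepending a letter to a reduced word either cancels its head or leaves it reduced. The
  value and the action respect this cancellation alike, so one reduced word serves both.\<close>

lemma ex_reduced_word:
  fixes f :: "'g \<times> bool \<Rightarrow> 'x \<Rightarrow> 'x"
  assumes G: "group G" "S \<subseteq> carrier G"
    and f: "\<And>s e x. s \<in> S \<Longrightarrow> f (s, e) (f (s, \<not> e) x) = x"
    and w: "set w \<subseteq> S \<times> UNIV"
  shows "\<exists>r \<in> reduced_words S. word_value G r = word_value G w \<and> foldr f r = foldr f w"
  using w
proof (induction w)
  case Nil
  then show ?case by (intro bexI[of _ "[]"]) (auto simp: reduced_words_def)
next
  case (Cons l w)
  interpret group G by fact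
  obtain s e where l: "l = (s, e)" "s \<in> S" using Cons.prems by (cases l) auto
  obtain r where r: "r \<in> reduced_words S" "word_value G r = word_value G w" "foldr f r = foldr f w"
    using Cons by auto
  have s: "s \<in> carrier G" using l G by auto
  show ?case
  proof (cases "r \<noteq> [] \<and> hd r = (s, \<not> e)")
    case True
    then obtain r' where r': "r = (s, \<not> e) # r'" by (cases r) auto
    have red: "r' \<in> reduced_words S"
      using r(1) unfolding r' reduced_words_def by (auto simp: successively_Cons)
    have "word_value G r' \<in> carrier G"
      using word_value_closed[OF G] red by (auto simp: reduced_words_def)
    then have "word_value G r' = word_value G (l # w)"
      using s by (auto simp: word_value_Cons r(2)[symmetric] r' l(1) m_assoc[symmetric])
    moreover have "foldr f r' = foldr f (l # w)"
      using f[OF l(2)] by (auto simp: r(3)[symmetric] r' l(1))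
    ultimately show ?thesis using red by blast
  next
    case False
    then have "l # r \<in> reduced_words S"
      using r(1) l by (cases r) (auto simp: reduced_words_def successively_Cons)
    moreover have "word_value G (l # r) = word_value G (l # w)"
      by (simp add: word_value_Cons r(2))
    ultimately show ?thesis using r(3) by (intro bexI[of _ "l # r"]) auto
  qed
qed

text \<open>Universal property of a free group: \<open>\<Phi>\<close> is read off the unique reduced
  word of an element. The formula for arbitrary words gives multiplicativity, since a concatenation
  of reduced words need not be reduced.\<close>

lemma free_basis_extend:
  fixes f :: "'g \<times> bool \<Rightarrow> 'x \<Rightarrow> 'x"
  assumes G: "group G" and S: "free_basis G S"
    and f: "\<And>s e x. s \<in> S \<Longrightarrow> f (s, e) (f (s, \<not> e) x) = x"
  obtains \<Phi> :: "'g \<Rightarrow> 'x \<Rightarrow> 'x" where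
    "\<And>w. set w \<subseteq> S \<times> UNIV \<Longrightarrow> \<Phi> (word_value G w) = foldr f w"
    "\<And>g h. g \<in> carrier G \<Longrightarrow> h \<in> carrier G \<Longrightarrow> \<Phi> (g \<otimes>\<^bsub>G\<^esub> h) = \<Phi> g \<circ> \<Phi> h"
proof -
  have SG: "S \<subseteq> carrier G" and bij: "bij_betw (word_value G) (reduced_words S) (carrier G)"
    using S by (auto simp: free_basis_def)
  define \<Phi> where "\<Phi> g = foldr f (inv_into (reduced_words S) (word_value G) g)" for g
  have val: "\<Phi> (word_value G w) = foldr f w" if w: "set w \<subseteq> S \<times> UNIV" for w
  proof -
    obtain r where r: "r \<in> reduced_words S" "word_value G r = word_value G w" "foldr f r = foldr f w"
      using ex_reduced_word[OF G SG f w] by blast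
    then have "inv_into (reduced_words S) (word_value G) (word_value G w) = r"
      using bij by (metis bij_betw_inv_into_left)
    then show ?thesis by (simp add: \<Phi>_def r(3))
  qed
  have "\<Phi> (g \<otimes>\<^bsub>G\<^esub> h) = \<Phi> g \<circ> \<Phi> h" if gh: "g \<in> carrier G" "h \<in> carrier G" for g h
  proof -
    obtain v w where vw: "v \<in> reduced_words S" "w \<in> reduced_words S"
      "g = word_value G v" "h = word_value G w"
      using gh bij by (metis bij_betw_imp_surj_on imageE)
    then have sub: "set v \<subseteq> S \<times> UNIV" "set w \<subseteq> S \<times> UNIV" by (auto simp: reduced_words_def)
    show ?thesis
      using val[of "v @ w"] val[OF sub(1)] val[OF sub(2)] sub
      by (simp add: vw word_value_append[OF G SG sub] fun_eq_iff)
  qed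
  with val that show ?thesis by blast
qed

section \<open>Maps determined by finitely many coordinates\<close>

lemma topspace_full_shift: "topspace (full_shift \<Sigma>) = {x. \<forall>i. x i \<in> \<Sigma>}"
  by (auto simp: full_shift_def)

text \<open>Around each of its points the set contains the cylinder that fixes the coordinates in
  \<open>J\<close>.\<close>

lemma openin_finitely_determined:
  assumes J: "finite J"
    and U: "\<And>x y. (\<And>i. x i \<in> \<Sigma>) \<Longrightarrow> (\<And>i. y i \<in> \<Sigma>) \<Longrightarrow> (\<And>j. j \<in> J \<Longrightarrow> x j = y j) \<Longrightarrow> P x \<Longrightarrow> P y"
  shows "openin (full_shift \<Sigma>) {x \<in> topspace (full_shift \<Sigma>). P x}"
proof (subst openin_subopen, intro ballI)
  fix x assume x: "x \<in> {x \<in> topspace (full_shift \<Sigma>). P x}"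
  let ?T = "PiE UNIV (\<lambda>j. if j \<in> J then {x j} else \<Sigma>)"
  have "openin (full_shift \<Sigma>) ?T"
    unfolding full_shift_def using x J
    by (subst openin_PiE_gen) (auto simp: topspace_full_shift elim!: rev_finite_subset)
  moreover have "x \<in> ?T" using x by (auto simp: topspace_full_shift)
  moreover have "?T \<subseteq> {x \<in> topspace (full_shift \<Sigma>). P x}"
  proof
    fix y assume "y \<in> ?T"
    then have y: "y j \<in> (if j \<in> J then {x j} else \<Sigma>)" for j by (rule PiE_mem) simp
    have "y j \<in> \<Sigma>" for j using y[of j] x by (auto simp: topspace_full_shift split: if_splits)
    moreover have "y j = x j" if "j \<in> J" for j using y[of j] that by simp
    ultimately show "y \<in> {x \<in> topspace (full_shift \<Sigma>). P x}"
      using x U[of x y] by (auto simp: topspace_full_shift)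
  qed
  ultimately show "\<exists>T. openin (full_shift \<Sigma>) T \<and> x \<in> T \<and> T \<subseteq> {x \<in> topspace (full_shift \<Sigma>). P x}"
    by blast
qed

text \<open>Agreement on \<open>J\<close> is symmetric, so the complement is finitely determined
  too.\<close>

lemma clopenin_finitely_determined:
  assumes J: "finite J"
    and U: "\<And>x y. (\<And>i. x i \<in> \<Sigma>) \<Longrightarrow> (\<And>i. y i \<in> \<Sigma>) \<Longrightarrow> (\<And>j. j \<in> J \<Longrightarrow> x j = y j) \<Longrightarrow> P x \<Longrightarrow> P y"
  shows "openin (full_shift \<Sigma>) {x \<in> topspace (full_shift \<Sigma>). P x}"
    "closedin (full_shift \<Sigma>) {x \<in> topspace (full_shift \<Sigma>). P x}"
proof -
  show "openin (full_shift \<Sigma>) {x \<in> topspace (full_shift \<Sigma>). P x}"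
    using openin_finitely_determined[OF assms] .
  have "openin (full_shift \<Sigma>) {x \<in> topspace (full_shift \<Sigma>). \<not> P x}"
  proof (rule openin_finitely_determined[OF J], rule notI)
    fix x y assume "\<And>i. x i \<in> \<Sigma>" "\<And>i. y i \<in> \<Sigma>" "\<And>j. j \<in> J \<Longrightarrow> x j = y j" "\<not> P x" "P y"
    then show False using U[of y x] by simp
  qed
  moreover have "topspace (full_shift \<Sigma>) - {x \<in> topspace (full_shift \<Sigma>). P x}
      = {x \<in> topspace (full_shift \<Sigma>). \<not> P x}" by auto
  ultimately show "closedin (full_shift \<Sigma>) {x \<in> topspace (full_shift \<Sigma>). P x}"
    by (auto simp: closedin_def)
qed

lemma continuous_map_finitely_determined:
  assumes J: "finite J"
    and T: "\<And>x. (\<And>i. x i \<in> \<Sigma>) \<Longrightarrow> f x \<in> T"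
    and U: "\<And>x y. (\<And>j. j \<in> J \<Longrightarrow> x j = y j) \<Longrightarrow> f x = f y"
  shows "continuous_map (full_shift \<Sigma>) (discrete_topology T) f"
  unfolding continuous_map_def
proof (intro conjI allI impI)
  show "f \<in> topspace (full_shift \<Sigma>) \<rightarrow> topspace (discrete_topology T)"
    using T by (auto simp: topspace_full_shift)
  fix V
  show "openin (full_shift \<Sigma>) {x \<in> topspace (full_shift \<Sigma>). f x \<in> V}"
  proof (rule openin_finitely_determined[OF J])
    fix x y assume "\<And>j. j \<in> J \<Longrightarrow> x j = y j" "f x \<in> V"
    then show "f y \<in> V" using U[of x y] by simp
  qed
qed

section \<open>The full shift as a zero-dimensional compact metrizable space\<close>

lemma full_shift_dim_le_0: "full_shift \<Sigma> dim_le 0"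
  unfolding dimension_le_0_neighbourhood_base_of_clopen
proof (subst open_neighbourhood_base_of)
  show "\<forall>U. closedin (full_shift \<Sigma>) U \<and> openin (full_shift \<Sigma>) U \<longrightarrow> openin (full_shift \<Sigma>) U"
    by simp
next
  have "\<exists>U. (closedin (full_shift \<Sigma>) U \<and> openin (full_shift \<Sigma>) U) \<and> x \<in> U \<and> U \<subseteq> W"
    if W: "openin (full_shift \<Sigma>) W" and x: "x \<in> W" for W x
  proof -
    obtain U where U: "finite {i. U i \<noteq> \<Sigma>}" "x \<in> PiE UNIV U" "PiE UNIV U \<subseteq> W"
      using W x unfolding full_shift_def openin_product_topology_alt by (auto dest!: bspec)
    \<comment> \<open>Only the finitely many coordinates that \<open>U\<close> really constrains are
      fixed, which makes a clopen cylinder inside the box.\<close>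
    let ?C = "{y \<in> topspace (full_shift \<Sigma>). \<forall>j \<in> {i. U i \<noteq> \<Sigma>}. y j = x j}"
    have clopen: "openin (full_shift \<Sigma>) ?C" "closedin (full_shift \<Sigma>) ?C"
      by (rule clopenin_finitely_determined[OF U(1)]; simp)+
    have "?C \<subseteq> PiE UNIV U"
    proof
      fix y assume y: "y \<in> ?C"
      have "y i \<in> U i" for i
        using y U(2) by (cases "U i = \<Sigma>") (auto simp: topspace_full_shift PiE_iff)
      then show "y \<in> PiE UNIV U" by auto
    qed
    moreover have "x \<in> ?C" using x openin_subset[OF W] by auto
    ultimately show ?thesis
      using clopen U(3) by (intro exI[of _ ?C]) auto
  qed
  then show "\<forall>W x. openin (full_shift \<Sigma>) W \<and> x \<in> W \<longrightarrow>
      (\<exists>U. (closedin (full_shift \<Sigma>) U \<and> openin (full_shift \<Sigma>) U) \<and> x \<in> U \<and> U \<subseteq> W)"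
    by simp
qed

lemma compact_space_full_shift:
  assumes "finite \<Sigma>" shows "compact_space (full_shift \<Sigma>)"
  using assms unfolding full_shift_def
  by (simp add: compact_space_product_topology compact_space_discrete_topology)

lemma metrizable_space_full_shift: "metrizable_space (full_shift \<Sigma>)"
  unfolding full_shift_def by (simp add: metrizable_space_product_topology)


section \<open>Unique visits exclude cancellation\<close>

text \<open>Take \<open>B = A\<close> and let \<open>\<theta>\<close> be the identity on the visited
  set \<open>C\<close> and trivial outside it. At a point with a unique visit from the support of
  \<open>f\<close>, the product reduces to one value of \<open>f\<close>, which is not
  neutral.\<close>

lemma unique_visits_not_has_cancellation:
  fixes A :: "nat monoid"
  assumes A: "comm_group A" "finite (carrier A)" and G: "group_action G (topspace X) \<phi>"
    and uv: "unique_visits G X \<phi>"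
  shows "\<not> has_cancellation G X \<phi> A"
proof
  assume canc: "has_cancellation G X \<phi> A"
  interpret A: comm_group A by fact
  obtain C where C: "openin X C" "closedin X C"
    and C_visit: "\<And>F. finite F \<Longrightarrow> F \<noteq> {} \<Longrightarrow> F \<subseteq> carrier G \<Longrightarrow>
        \<exists>x \<in> topspace X. \<exists>!g. g \<in> F \<and> \<phi> g x \<in> C"
    using uv unfolding unique_visits_def by metis
  define \<theta> where "\<theta> x = (if x \<in> C then restrict (\<lambda>a. a) (carrier A)
      else restrict (\<lambda>_. \<one>\<^bsub>A\<^esub>) (carrier A))" for x
  have "continuous_map X (discrete_topology (Hom_set A A)) \<theta>"
    unfolding continuous_map_def
  proof (intro conjI allI impI)
    show "\<theta> \<in> topspace X \<rightarrow> topspace (discrete_topology (Hom_set A A))"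
      by (auto simp: \<theta>_def Hom_set_def hom_def)
    fix V
    let ?c = "restrict (\<lambda>a. a) (carrier A)" and ?d = "restrict (\<lambda>_. \<one>\<^bsub>A\<^esub>) (carrier A)"
    \<comment> \<open>Only two values occur. The union also covers a trivial \<open>A\<close>, where
      they coincide.\<close>
    have "{x \<in> topspace X. \<theta> x \<in> V} =
        (if ?c \<in> V then C else {}) \<union> (if ?d \<in> V then topspace X - C else {})"
      using openin_subset[OF C(1)] by (auto simp: \<theta>_def)
    then show "openin X {x \<in> topspace X. \<theta> x \<in> V}"
      using C by auto
  qed
  then have "has_cancellation_wrt G X \<phi> A \<theta> A"
    using canc A unfolding has_cancellation_def by blast
  then obtain f where f: "f \<in> carrier G \<rightarrow> carrier A"
    and F: "finite {g \<in> carrier G. f g \<noteq> \<one>\<^bsub>A\<^esub>}" "{g \<in> carrier G. f g \<noteq> \<one>\<^bsub>A\<^esub>} \<noteq> {}"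
    and zero: "\<And>x. x \<in> topspace X \<Longrightarrow>
        finprod A (\<lambda>g. \<theta> (\<phi> g x) (f g)) {g \<in> carrier G. f g \<noteq> \<one>\<^bsub>A\<^esub>} = \<one>\<^bsub>A\<^esub>"
    unfolding has_cancellation_wrt_def by blast
  let ?F = "{g \<in> carrier G. f g \<noteq> \<one>\<^bsub>A\<^esub>}"
  obtain x g where x: "x \<in> topspace X" and g: "g \<in> ?F" "\<phi> g x \<in> C"
    and uniq: "\<And>h. h \<in> ?F \<Longrightarrow> \<phi> h x \<in> C \<Longrightarrow> h = g"
    using C_visit[OF F] by blast
  have "finprod A (\<lambda>h. \<theta> (\<phi> h x) (f h)) ?F = finprod A (\<lambda>h. if g = h then f h else \<one>\<^bsub>A\<^esub>) ?F"
  proof (rule A.finprod_cong')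
    fix h assume h: "h \<in> ?F"
    then have "f h \<in> carrier A" using f by auto
    then show "\<theta> (\<phi> h x) (f h) = (if g = h then f h else \<one>\<^bsub>A\<^esub>)"
      using uniq[OF h] g(2) by (auto simp: \<theta>_def)
  qed (use f in auto)
  also have "\<dots> = f g"
    using A.finprod_singleton[OF g(1) F(1)] f by auto
  finally show False using zero[OF x] g by auto
qed

section \<open>Involutions of a full shift\<close>

text \<open>A symbol \<open>2 * l + d\<close> carries a label \<open>l\<close> and a bit \<open>d\<close>.  Cell \<open>i\<close> starts an \<open>s\<close>-edge to
  \<open>i + 1\<close> if it carries label \<open>s\<close> and \<open>i - 1\<close> does not; so the \<open>s\<close>-edges are pairwise disjoint and
  exchanging the bits along all of them is an involution.\<close>

definition edge :: "nat \<Rightarrow> nat config \<Rightarrow> int \<Rightarrow> bool" where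
  "edge s x i \<longleftrightarrow> x i div 2 = s \<and> x (i - 1) div 2 \<noteq> s"

definition partner :: "nat \<Rightarrow> nat config \<Rightarrow> int \<Rightarrow> int" where
  "partner s x i = (if edge s x i then i + 1 else if edge s x (i - 1) then i - 1 else i)"

definition flip :: "nat \<Rightarrow> nat config \<Rightarrow> nat config" where
  "flip s x = (\<lambda>i. 2 * (x i div 2) + x (partner s x i) mod 2)"

text \<open>Traces the bit read at a cell back to its origin. In \<open>foldr flip w\<close> the
  first letter of \<open>w\<close> acts last, so it is the first to be traced.\<close>

fun walk :: "nat list \<Rightarrow> nat config \<Rightarrow> int \<Rightarrow> int" where
  "walk [] x i = i"
| "walk (s # w) x i = walk w x (partner s x i)"

lemma partner_cong:
  assumes "\<And>j. x j div 2 = y j div 2"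
  shows "partner s x = partner s y"
  by (simp add: partner_def edge_def assms fun_eq_iff)

text \<open>No cell lies on two \<open>s\<close>-edges: \<open>edge s x i\<close> and
  \<open>edge s x (i - 1)\<close> demand opposite things of the label at
  \<open>i - 1\<close>.\<close>

lemma partner_partner: "partner s x (partner s x i) = i"
  by (auto simp: partner_def edge_def)

lemma flip_div: "flip s x i div 2 = x i div 2"
  by (simp add: flip_def)

lemma flip_mod: "flip s x i mod 2 = x (partner s x i) mod 2"
  by (simp add: flip_def)

lemma flip_flip: "flip s (flip s x) = x"
proof
  fix i
  have "flip s (flip s x) i = 2 * (x i div 2) + x i mod 2"
    unfolding flip_def[of s "flip s x"] flip_div flip_mod partner_cong[of "flip s x" x, OF flip_div]
      partner_partner ..
  then show "flip s (flip s x) i = x i" by simp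
qed

text \<open>Flips keep all labels, so every partner along the way can be computed in the initial
  configuration.\<close>

lemma foldr_flip: "foldr flip w x i = 2 * (x i div 2) + x (walk w x i) mod 2"
proof (induction w arbitrary: i)
  case (Cons s w)
  have "partner s (foldr flip w x) = partner s x"
    by (rule partner_cong) (simp add: Cons.IH)
  then show ?case by (simp add: flip_def[of s "foldr flip w x"] Cons.IH)
qed simp

lemma foldr_flip_rev: "foldr flip (rev w) (foldr flip w x) = x"
  by (induction w arbitrary: x) (simp_all add: flip_flip)

lemma foldr_flip_rev': "foldr flip w (foldr flip (rev w) x) = x"
  using foldr_flip_rev[of "rev w" x] by simp

lemma partner_bounds: "\<bar>partner s x i - i\<bar> \<le> 1"
  by (simp add: partner_def)

lemma walk_bounds: "\<bar>walk w x i - i\<bar> \<le> int (length w)"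
proof (induction w arbitrary: i)
  case (Cons s w)
  show ?case using Cons.IH[of "partner s x i"] partner_bounds[of s x i] by simp
qed simp

text \<open>Each letter moves by at most one cell, so covering the distance \<open>length w\<close>
  forces every step to go right. A right step by \<open>s\<close> starts at a cell labelled
  \<open>s\<close>.\<close>

lemma walk_extremal:
  assumes "walk w x i = i + int (length w)" "k < length w"
  shows "x (i + int k) div 2 = w ! k"
  using assms
proof (induction w arbitrary: i k)
  case (Cons s w)
  have "partner s x i = i + 1"
    using Cons.prems(1) walk_bounds[of w x "partner s x i"] partner_bounds[of s x i] by simp
  then have s: "x i div 2 = s" and p: "walk w x (i + 1) = i + 1 + int (length w)"
    using Cons.prems(1) by (auto simp: partner_def edge_def split: if_splits)
  show ?case
  proof (cases k)
    case (Suc m)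
    then show ?thesis using Cons.IH[OF p, of m] Cons.prems(2) by (simp add: algebra_simps)
  qed (simp add: s)
qed simp

section \<open>Probing a word\<close>

text \<open>The labels of the probe spell \<open>w\<close> on the cells \<open>0, \<dots>, |w| - 1\<close>, so that among all words of
  length at most \<open>|w|\<close> only \<open>w\<close> itself brings the bit of cell \<open>|w|\<close> to cell \<open>0\<close>.\<close>

definition probe :: "nat list \<Rightarrow> nat \<Rightarrow> nat config" where
  "probe w d = periodic (map ((*) 2) w @ [d, 0] @ replicate (length w) 0)"

lemma probe_eq:
  "probe w d i = (let j = i mod (2 * int (length w) + 2) in
     if j < int (length w) then 2 * w ! nat j else if j = int (length w) then d else 0)"
proof -
  define j where "j = i mod (2 * int (length w) + 2)"
  have j: "0 \<le> j" "j < 2 * int (length w) + 2" by (simp_all add: j_def)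
  have "int (length (map ((*) 2) w @ [d, 0] @ replicate (length w) 0)) = 2 * int (length w) + 2"
    by simp
  then have "probe w d i = (map ((*) 2) w @ [d, 0] @ replicate (length w) 0) ! nat j"
    by (simp only: probe_def periodic_def j_def)
  also have "\<dots> = (if j < int (length w) then 2 * w ! nat j else if j = int (length w) then d else 0)"
  proof -
    consider "j < int (length w)" | "j = int (length w)" | "j = int (length w) + 1"
      | "j > int (length w) + 1" by linarith
    then show ?thesis
    proof cases
      case 4
      then obtain m where m: "nat j = length w + 2 + m" "m < length w"
        using j by (intro that[of "nat j - length w - 2"]) auto
      then show ?thesis using 4 by (simp add: nth_append)
    qed (use j in \<open>auto simp: nth_append nat_add_distrib\<close>)
  qed
  finally show ?thesis by (simp add: j_def)
qed

lemma probe_div: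
  assumes "d < 2"
  shows "probe w d i div 2 = (let j = i mod (2 * int (length w) + 2) in
     if j < int (length w) then w ! nat j else 0)"
  using assms by (simp add: probe_eq Let_def)

lemma probe_mod:
  assumes "d < 2"
  shows "probe w d i mod 2 = (if i mod (2 * int (length w) + 2) = int (length w) then d else 0)"
  using assms by (simp add: probe_eq Let_def)

text \<open>The bit \<open>d\<close> sits at cell \<open>length w\<close> and, one period earlier,
  at \<open>- length w - 2\<close>. All cells strictly between carry bit 0.\<close>

lemma probe_mod_near:
  assumes "d < 2" "i < int (length w)" "- int (length w) - 2 < i"
  shows "probe w d i mod 2 = 0"
proof -
  have "i mod (2 * int (length w) + 2) \<noteq> int (length w)"
  proof (cases "i < 0")
    case True
    then have "i mod (2 * int (length w) + 2) = i + (2 * int (length w) + 2)"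
      using assms by (subst mod_add_self2[symmetric], subst mod_pos_pos_trivial) auto
    then show ?thesis using assms by simp
  qed (use assms in simp)
  then show ?thesis using probe_mod[OF assms(1)] by simp
qed

lemma probe_in_alphabet:
  assumes "set w \<subseteq> {..<5}" "d < 2"
  shows "probe w d i \<in> {..<10}"
proof -
  have "w ! nat j < 5" if "0 \<le> j" "j < int (length w)" for j
    using assms(1) that by (auto dest!: subsetD simp: nth_mem)
  then show ?thesis using assms(2) by (fastforce simp: probe_eq Let_def)
qed

text \<open>Each cell \<open>k < length w\<close> starts an edge labelled \<open>w ! k\<close>,
  because the cell before it has another label: adjacent letters differ, and cell -1 has label 0,
  which \<open>w\<close> avoids.\<close>

lemma walk_probe_self:
  assumes w: "distinct_adj w" "0 \<notin> set w" and d: "d < 2"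
  shows "walk w (probe w d) 0 = int (length w)"
proof -
  let ?n = "length w" and ?x = "probe w d"
  have lab: "?x (int k) div 2 = w ! k" if "k < ?n" for k
    using that d by (simp add: probe_div Let_def)
  have step: "partner (w ! k) ?x (int k) = int (Suc k)" if k: "k < ?n" for k
  proof -
    have "?x (int k - 1) div 2 \<noteq> w ! k"
    proof (cases k)
      case 0
      \<comment> \<open>Cell -1 is the last cell of the preceding period, a padding zero.\<close>
      have "(- 1) mod (2 * int ?n + 2) = 2 * int ?n + 1"
        by (simp add: zmod_minus1)
      then have "?x (- 1) div 2 = 0" using d by (simp add: probe_div Let_def)
      then show ?thesis using k w(2) 0 nth_mem[OF k] by (metis diff_0 of_nat_0)
    next
      case (Suc m)
      then show ?thesis using lab[of m] k distinct_adj_nth[OF w(1), of m] by simp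
    qed
    then show ?thesis using lab[OF k] by (simp add: partner_def edge_def)
  qed
  \<comment> \<open>Induction on the number \<open>m\<close> of letters still to be walked.\<close>
  have "walk (drop (?n - m) w) ?x (int (?n - m)) = int ?n" if "m \<le> ?n" for m
    using that
  proof (induction m)
    case (Suc m)
    let ?k = "?n - Suc m"
    have k: "?k < ?n" "Suc ?k = ?n - m" using Suc.prems by auto
    have "drop ?k w = w ! ?k # drop (?n - m) w"
      using Cons_nth_drop_Suc[OF k(1)] k(2) by simp
    then show ?case using Suc step[OF k(1)] k(2) by simp
  qed simp
  from this[of ?n] show ?thesis by simp
qed

text \<open>A walk reaching cell \<open>length w\<close> would be extremal, and the labels it reads
  would spell \<open>w\<close>.\<close>

lemma walk_probe_other:
  assumes d: "d < 2" and t: "length t \<le> length w" "t \<noteq> w"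
  shows "walk t (probe w d) 0 < int (length w)"
proof (rule ccontr)
  assume "\<not> ?thesis"
  then have len: "length t = length w" and eq: "walk t (probe w d) 0 = 0 + int (length t)"
    using walk_bounds[of t "probe w d" 0] t(1) by auto
  have "t ! k = w ! k" if k: "k < length t" for k
    using walk_extremal[OF eq k] k len d by (simp add: probe_div Let_def)
  then show False using len t(2) by (simp add: list_eq_iff_nth_eq)
qed

section \<open>Reading the probe at cells 0 and -1\<close>

lemma foldr_flip_probe_self:
  assumes "distinct_adj w" "0 \<notin> set w" "d < 2"
  shows "foldr flip w (probe w d) 0 mod 2 = d"
  using assms by (simp add: foldr_flip walk_probe_self probe_mod)

lemma foldr_flip_probe_other:
  assumes "length t \<le> length w" "t \<noteq> w" "d < 2"
  shows "foldr flip t (probe w d) 0 mod 2 = 0"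
  using walk_probe_other[OF assms(3,1,2)] walk_bounds[of t "probe w d" 0] assms
  by (simp add: foldr_flip probe_mod_near)

text \<open>From cell -1 a walk ends between \<open>- length w - 1\<close> and
  \<open>length w - 1\<close>, just missing both nearest copies of \<open>d\<close>.\<close>

lemma foldr_flip_probe_minus_1:
  assumes "length t \<le> length w" "d < 2"
  shows "foldr flip t (probe w d) (-1) mod 2 = 0"
  using walk_bounds[of t "probe w d" "-1"] assms
  by (simp add: foldr_flip probe_mod_near)

lemma foldr_flip_probe_div:
  assumes "d < 2"
  shows "foldr flip t (probe w d) i div 2 = probe w 0 i div 2"
  using assms by (simp add: foldr_flip probe_div)

lemma foldr_flip_neq_id:
  assumes "distinct_adj w" "0 \<notin> set w" "w \<noteq> []"
  shows "foldr flip w \<noteq> id"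
proof
  assume "foldr flip w = id"
  \<comment> \<open>The empty word acts as the identity and reads bit 0 where \<open>w\<close> reads
    bit 1.\<close>
  then show False
    using foldr_flip_probe_self[OF assms(1,2), of 1] foldr_flip_probe_other[of "[]" w 1] assms(3)
    by simp
qed

section \<open>Encoding free generators by products of involutions\<close>

text \<open>The \<open>k\<close>-th free generator becomes \<open>u cd u\<inverse>\<close>, where \<open>u = abab\<dots>\<close> has length \<open>k\<close>
  and \<open>a, b, c, d\<close> are the involutions with labels 1 to 4.  Between two consecutive such factors
  the letters \<open>a\<close> and \<open>b\<close> may cancel, but never the letters \<open>c\<close> and \<open>d\<close>.\<close>

definition alt :: "nat \<Rightarrow> nat list" where
  "alt k = map (\<lambda>i. if even i then 1 else 2) [0..<k]"

definition core :: "bool \<Rightarrow> nat list" where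
  "core e = (if e then [3, 4] else [4, 3])"

definition code :: "nat \<times> bool \<Rightarrow> nat list" where
  "code l = alt (fst l) @ core (snd l) @ rev (alt (fst l))"

lemma set_alt: "set (alt k) \<subseteq> {1, 2}"
  by (auto simp: alt_def)

lemma distinct_adj_alt: "distinct_adj (alt k)"
  by (auto simp: distinct_adj_conv_nth alt_def)

lemma core_cases: "core e \<noteq> []" "hd (core e) \<in> {3, 4}" "last (core e) \<in> {3, 4}"
  "distinct_adj (core e)" "set (core e) = {3, 4}" "rev (core e) = core (\<not> e)"
  "last (core e) \<noteq> hd (core e)"
  by (auto simp: core_def)

text \<open>Reversal inverts a product of involutions, so a generator and its formal inverse get
  mutually inverse codes.\<close>

lemma rev_code: "rev (code (k, e)) = code (k, \<not> e)"
  by (simp add: code_def core_cases)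

lemma alt_append: "m \<le> n \<Longrightarrow> \<exists>y. alt n = alt m @ y \<and> length y = n - m"
  unfolding alt_def by (metis le_add_diff_inverse length_map length_upt map_append upt_add_eq_append zero_le)

text \<open>One alternating word is a prefix of the other. What remains after cancellation is the
  other's nonempty tail, possibly reversed.\<close>

lemma ex_alt_quotient:
  assumes "m \<noteq> n"
  shows "\<exists>y. y \<noteq> [] \<and> set y \<subseteq> {1, 2} \<and> distinct_adj y \<and>
    (\<forall>x. foldr flip (rev (alt m)) (foldr flip (alt n) x) = foldr flip y x)"
proof (cases "m < n")
  case True
  then obtain y where y: "alt n = alt m @ y" "length y = n - m" using alt_append[of m n] by auto
  show ?thesis
    using True y set_alt[of n] distinct_adj_alt[of n]
    by (intro exI[of _ y]) (auto simp: foldr_flip_rev)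
next
  case False
  then obtain y where y: "alt m = alt n @ y" "length y = m - n"
    using alt_append[of n m] by auto
  have "foldr flip (rev (alt m)) (foldr flip (alt n) x) = foldr flip (rev y) x" for x
    by (simp add: y(1) foldr_flip_rev)
  then show ?thesis
    using False assms y set_alt[of m] distinct_adj_alt[of m]
    by (intro exI[of _ "rev y"]) auto
qed

text \<open>The normal form displays its prefix \<open>alt (\<iota> s) @ core e\<close> so that the
  induction can go on: a factor put in front can cancel letters of this \<open>alt\<close> only,
  never of the \<open>core\<close>.\<close>

lemma code_reduced_word:
  assumes "r \<in> reduced_words S" "r = (s, e) # r'" "inj_on \<iota> S"
  shows "\<exists>z. set z \<subseteq> {1, 2, 3, 4} \<and> distinct_adj (alt (\<iota> s) @ core e @ z) \<and>
    foldr flip (alt (\<iota> s) @ core e @ z) = foldr (\<lambda>l. foldr flip (code (\<iota> (fst l), snd l))) r"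
  using assms(1,2)
proof (induction r arbitrary: s e r')
  case (Cons l r)
  then have l: "l = (s, e)" and s: "s \<in> S" by (auto simp: reduced_words_def)
  show ?case
  proof (cases r)
    case Nil
    let ?z = "rev (alt (\<iota> s))"
    have "set ?z \<subseteq> {1, 2}" using set_alt by auto
    moreover have "distinct_adj (alt (\<iota> s) @ core e @ ?z)"
    proof -
      have "last (alt (\<iota> s)) \<in> {1, 2}" if "alt (\<iota> s) \<noteq> []"
        using set_alt that last_in_set by blast
      then show ?thesis
        using core_cases(1-4)[of e] distinct_adj_alt[of "\<iota> s"]
        by (auto simp: distinct_adj_append_iff hd_rev)
    qed
    ultimately show ?thesis by (intro exI[of _ ?z]) (auto simp: Nil l code_def)
  next
    case r: (Cons l' q)
    obtain t d where l': "l' = (t, d)" by force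
    have rr: "r \<in> reduced_words S" and nc: "\<not> (s = t \<and> e \<noteq> d)" and t: "t \<in> S"
      using Cons.prems(1) by (auto simp: reduced_words_def l r l')
    obtain z where z: "set z \<subseteq> {1, 2, 3, 4}" "distinct_adj (alt (\<iota> t) @ core d @ z)"
      "foldr flip (alt (\<iota> t) @ core d @ z) = foldr (\<lambda>l. foldr flip (code (\<iota> (fst l), snd l))) r"
      using Cons.IH[OF rr] r l' by blast
    have tail: "distinct_adj (core d @ z)" using z(2) by blast
    have fold: "foldr (\<lambda>l. foldr flip (code (\<iota> (fst l), snd l))) (l # r) x
      = foldr flip (alt (\<iota> s)) (foldr flip (core e) (foldr flip (rev (alt (\<iota> s)))
          (foldr flip (alt (\<iota> t)) (foldr flip (core d @ z) x))))" for x
      unfolding foldr_Cons comp_apply z(3)[symmetric] by (simp add: l code_def)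
    show ?thesis
    proof (cases "s = t")
      case True
      then have "d = e" using nc by auto
      \<comment> \<open>The inner alternating words cancel completely and equal cores meet; a core
        ends in a letter other than its first.\<close>
      have "distinct_adj (alt (\<iota> s) @ core e @ core e @ z)"
        using z(2) core_cases(1,4,7)[of e] True \<open>d = e\<close>
        by (auto simp: distinct_adj_append_iff)
      moreover have "foldr flip (alt (\<iota> s) @ core e @ core e @ z)
          = foldr (\<lambda>l. foldr flip (code (\<iota> (fst l), snd l))) (l # r)"
        unfolding fun_eq_iff[of _ "foldr (\<lambda>l. foldr flip (code (\<iota> (fst l), snd l))) (l # r)"] fold
        by (simp add: True \<open>d = e\<close> foldr_flip_rev)
      ultimately show ?thesis
        using z(1) core_cases(5)[of e] by (intro exI[of _ "core e @ z"]) auto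
    next
      case False
      then have "\<iota> s \<noteq> \<iota> t" using assms(3) s t by (auto dest: inj_onD)
      then obtain y where y: "y \<noteq> []" "set y \<subseteq> {1, 2}" "distinct_adj y"
        "\<And>x. foldr flip (rev (alt (\<iota> s))) (foldr flip (alt (\<iota> t)) x) = foldr flip y x"
        using ex_alt_quotient by metis
      have hl: "hd y \<in> {1, 2}" "last y \<in> {1, 2}"
        using y(2) hd_in_set[OF y(1)] last_in_set[OF y(1)] by blast+
      have "last (alt (\<iota> s)) \<in> {1, 2}" if "alt (\<iota> s) \<noteq> []"
        using set_alt that last_in_set by blast
      then have "distinct_adj (alt (\<iota> s) @ core e @ y @ core d @ z)"
        \<comment> \<open>The nonempty \<open>y\<close> over the letters 1 and 2 keeps the two cores
          apart.\<close>
        using tail y(1,3) hl core_cases(1-4)[of e] core_cases(1-4)[of d] distinct_adj_alt[of "\<iota> s"]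
        by (auto simp: distinct_adj_append_iff)
      moreover have "foldr flip (alt (\<iota> s) @ core e @ y @ core d @ z)
          = foldr (\<lambda>l. foldr flip (code (\<iota> (fst l), snd l))) (l # r)"
        unfolding fun_eq_iff[of _ "foldr (\<lambda>l. foldr flip (code (\<iota> (fst l), snd l))) (l # r)"] fold
        by (simp add: y(4))
      ultimately show ?thesis
        using z(1) y(2) core_cases(5)[of d] by (intro exI[of _ "y @ core d @ z"]) auto
    qed
  qed
qed simp

lemma ex_word_action:
  fixes G :: "('g, 'm) monoid_scheme"
  assumes "free_group G" "countable (carrier G)"
  shows "\<exists>\<Phi> W. (\<forall>g \<in> carrier G. \<forall>h \<in> carrier G. \<Phi> (g \<otimes>\<^bsub>G\<^esub> h) = \<Phi> g \<circ> \<Phi> h) \<and>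
    inj_on W (carrier G) \<and>
    (\<forall>g \<in> carrier G. set (W g) \<subseteq> {1, 2, 3, 4} \<and> distinct_adj (W g) \<and> \<Phi> g = foldr flip (W g))"
proof -
  obtain S where G: "group G" and S: "free_basis G S" using assms(1) by (auto simp: free_group_def)
  interpret group G by fact
  have SG: "S \<subseteq> carrier G" and bij: "bij_betw (word_value G) (reduced_words S) (carrier G)"
    using S by (auto simp: free_basis_def)
  \<comment> \<open>Countability enters here: numbering the elements gives distinct generators
    alternating words of distinct lengths.\<close>
  define \<iota> where "\<iota> = to_nat_on (carrier G)"
  have inj: "inj_on \<iota> S"
    unfolding \<iota>_def using inj_on_to_nat_on[OF assms(2)] SG by (rule inj_on_subset)
  define f where "f l = foldr flip (code (\<iota> (fst l), snd l))" for l
  have "f (s, e) (f (s, \<not> e) x) = x" for s e x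
    using foldr_flip_rev[of "code (\<iota> s, \<not> e)" x] by (simp add: f_def rev_code)
  then obtain \<Phi> where \<Phi>: "\<And>w. set w \<subseteq> S \<times> UNIV \<Longrightarrow> \<Phi> (word_value G w) = foldr f w"
    and mult: "\<And>g h. g \<in> carrier G \<Longrightarrow> h \<in> carrier G \<Longrightarrow> \<Phi> (g \<otimes>\<^bsub>G\<^esub> h) = \<Phi> g \<circ> \<Phi> h"
    using free_basis_extend[OF G S, of f] by metis
  have one: "\<Phi> \<one>\<^bsub>G\<^esub> = id" using \<Phi>[of "[]"] by simp
  have "\<exists>w. set w \<subseteq> {1, 2, 3, 4} \<and> distinct_adj w \<and> \<Phi> g = foldr flip w \<and> (g \<noteq> \<one>\<^bsub>G\<^esub> \<longrightarrow> w \<noteq> [])"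
    if g: "g \<in> carrier G" for g
  proof -
    obtain r where r: "r \<in> reduced_words S" "g = word_value G r"
      using g bij by (metis bij_betw_imp_surj_on imageE)
    have \<Phi>g: "\<Phi> g = foldr f r" using \<Phi> r by (auto simp: reduced_words_def)
    show ?thesis
    proof (cases r)
      case Nil
      then show ?thesis using r \<Phi>g by (intro exI[of _ "[]"]) auto
    next
      case (Cons l r')
      obtain s e where l: "l = (s, e)" by force
      obtain z where z: "set z \<subseteq> {1, 2, 3, 4}" "distinct_adj (alt (\<iota> s) @ core e @ z)"
        "foldr flip (alt (\<iota> s) @ core e @ z) = foldr f r"
        using code_reduced_word[OF r(1) Cons[unfolded l] inj] unfolding f_def by blast
      show ?thesis
        using z \<Phi>g core_cases(1,5)[of e] set_alt[of "\<iota> s"]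
        by (intro exI[of _ "alt (\<iota> s) @ core e @ z"]) auto
    qed
  qed
  then obtain W where W: "\<And>g. g \<in> carrier G \<Longrightarrow> set (W g) \<subseteq> {1, 2, 3, 4} \<and> distinct_adj (W g)
      \<and> \<Phi> g = foldr flip (W g) \<and> (g \<noteq> \<one>\<^bsub>G\<^esub> \<longrightarrow> W g \<noteq> [])"
    by metis
  have "inj_on W (carrier G)"
  proof (rule inj_onI)
    fix g h assume gh: "g \<in> carrier G" "h \<in> carrier G" "W g = W h"
    \<comment> \<open>Equal words give equal maps, so the quotient acts as the identity. A
      nontrivial element has a nonempty word, which acts nontrivially.\<close>
    have "\<Phi> (g \<otimes>\<^bsub>G\<^esub> inv\<^bsub>G\<^esub> h) = \<Phi> h \<circ> \<Phi> (inv\<^bsub>G\<^esub> h)" using gh W mult by simp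
    also have "\<dots> = id" using gh one by (simp flip: mult)
    finally have "foldr flip (W (g \<otimes>\<^bsub>G\<^esub> inv\<^bsub>G\<^esub> h)) = id" using W gh by simp
    moreover have "g \<otimes>\<^bsub>G\<^esub> inv\<^bsub>G\<^esub> h \<in> carrier G" using gh by simp
    ultimately have "g \<otimes>\<^bsub>G\<^esub> inv\<^bsub>G\<^esub> h = \<one>\<^bsub>G\<^esub>"
      using W[of "g \<otimes>\<^bsub>G\<^esub> inv\<^bsub>G\<^esub> h"] foldr_flip_neq_id[of "W (g \<otimes>\<^bsub>G\<^esub> inv\<^bsub>G\<^esub> h)"] by force
    then show "g = h" using gh by (metis inv_equality inv_inv inv_closed)
  qed
  then show ?thesis
    by (intro exI[of _ \<Phi>] exI[of _ W]) (use mult W in simp)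
qed

section \<open>The action on the full shift\<close>

lemma flip_in_alphabet:
  assumes "x \<in> topspace (full_shift {..<10})"
  shows "flip s x \<in> topspace (full_shift {..<10})"
proof -
  \<comment> \<open>The label comes from \<open>a\<close> alone and is at most 4, whichever bit
    joins it.\<close>
  have bound: "2 * (a div 2) + b mod 2 < 10" if "a < 10" for a b :: nat
    using that by presburger
  have "x i < 10" for i using assms by (simp add: topspace_full_shift)
  then show ?thesis using bound by (simp add: topspace_full_shift flip_def)
qed

lemma foldr_flip_in_alphabet:
  assumes "x \<in> topspace (full_shift {..<10})"
  shows "foldr flip w x \<in> topspace (full_shift {..<10})"
  using assms by (induction w) (auto intro: flip_in_alphabet)

lemma continuous_map_flip: "continuous_map (full_shift {..<10}) (full_shift {..<10}) (flip s)"
proof -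
  have "continuous_map (full_shift {..<10}) (discrete_topology {..<10}) (\<lambda>x. flip s x k)" for k
  \<comment> \<open>Deciding on an edge from \<open>k - 1\<close> to \<open>k\<close> involves the
    label at \<open>k - 2\<close>; an edge from \<open>k\<close> brings the bit of
    \<open>k + 1\<close>.\<close>
  proof (rule continuous_map_finitely_determined[of "{k - 2, k - 1, k, k + 1}"])
    show "flip s x k \<in> {..<10}" if "\<And>i. x i \<in> {..<10}" for x
      using flip_in_alphabet[of x s] that by (auto simp: topspace_full_shift)
    show "flip s x k = flip s y k" if "\<And>j. j \<in> {k - 2, k - 1, k, k + 1} \<Longrightarrow> x j = y j" for x y
    proof -
      have "x (k - 2) = y (k - 2)" "x (k - 1) = y (k - 1)" "x k = y k" "x (k + 1) = y (k + 1)"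
        by (rule that; simp)+
      then show ?thesis by (simp add: flip_def partner_def edge_def)
    qed
  qed simp
  then show ?thesis
    by (simp add: full_shift_def continuous_map_componentwise_UNIV)
qed

lemma continuous_map_foldr_flip:
  "continuous_map (full_shift {..<10}) (full_shift {..<10}) (foldr flip w)"
proof (induction w)
  case (Cons s w)
  then have "continuous_map (full_shift {..<10}) (full_shift {..<10}) (flip s \<circ> foldr flip w)"
    using continuous_map_flip continuous_map_compose by blast
  then show ?case by (simp add: comp_def)
qed (simp add: id_def[symmetric])

lemma flip_shift: "flip s (shift x) = shift (flip s x)"
  by (simp add: flip_def shift_def partner_def edge_def fun_eq_iff algebra_simps)

lemma foldr_flip_shift: "foldr flip w (shift x) = shift (foldr flip w x)"
  by (induction w) (simp_all add: flip_shift)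

text \<open>The reversed word gives the continuous inverse. The restriction matches the extensional
  elements of \<open>Aut_shift\<close>.\<close>

lemma homeomorphic_map_foldr_flip:
  "homeomorphic_map (full_shift {..<10}) (full_shift {..<10})
     (restrict (foldr flip w) (topspace (full_shift {..<10})))"
proof -
  have "homeomorphic_maps (full_shift {..<10}) (full_shift {..<10}) (foldr flip w) (foldr flip (rev w))"
    by (simp add: homeomorphic_maps_def continuous_map_foldr_flip foldr_flip_rev foldr_flip_rev')
  then have "homeomorphic_map (full_shift {..<10}) (full_shift {..<10}) (foldr flip w)"
    by (rule homeomorphic_maps_imp_map)
  then show ?thesis by (rule homeomorphic_map_eq) simp
qed

lemma foldr_flip_in_Aut_shift:
  "restrict (foldr flip w) (topspace (full_shift {..<10})) \<in> carrier (Aut_shift {..<10})"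
proof -
  let ?X = "topspace (full_shift {..<10})"
  have "bij_betw (restrict (foldr flip w) ?X) ?X ?X"
    using homeomorphic_map_foldr_flip[of w]
    by (simp only: bij_betw_def homeomorphic_imp_surjective_map homeomorphic_imp_injective_map)
  moreover have "shift x \<in> ?X" if "x \<in> ?X" for x
    using that by (simp add: topspace_full_shift shift_def)
  ultimately show ?thesis
    using homeomorphic_map_foldr_flip[of w]
    by (auto simp: Aut_shift_def Bij_def foldr_flip_shift)
qed

text \<open>Supplies the element whose probe singles it out; injectivity handles other words of
  maximal length.\<close>

lemma ex_longest:
  assumes "finite F" "F \<noteq> {}" "inj_on W F"
  shows "\<exists>g \<in> F. \<forall>h \<in> F - {g}. length (W h) \<le> length (W g) \<and> W h \<noteq> W g"
proof -
  let ?L = "(\<lambda>h. length (W h)) ` F"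
  have "Max ?L \<in> ?L" using assms(1,2) by (intro Max_in) auto
  then obtain g where "g \<in> F" "length (W g) = Max ?L" by auto
  moreover have "length (W h) \<le> Max ?L" if "h \<in> F" for h using assms(1) that by (intro Max_ge) auto
  ultimately show ?thesis using assms(3) by (intro bexI[of _ g]) (auto dest: inj_onD)
qed

theorem corollary3:
  fixes G :: "('g, 'm) monoid_scheme"
  assumes "free_group G" and "countable (carrier G)"
  shows "\<exists>(\<Sigma> :: nat set) \<phi>.
    finite \<Sigma> \<and> card \<Sigma> \<ge> 2 \<and>
    acts_with_property_P G \<Sigma> \<phi> \<and>
    G_system G (full_shift \<Sigma>) \<phi> \<and>
    unique_visits G (full_shift \<Sigma>) \<phi> \<and>
    (\<forall>A :: nat monoid. comm_group A \<and> finite (carrier A) \<longrightarrow>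
      \<not> has_cancellation G (full_shift \<Sigma>) \<phi> A)"
proof -
  obtain \<Phi> W where mult: "\<And>g h. g \<in> carrier G \<Longrightarrow> h \<in> carrier G \<Longrightarrow> \<Phi> (g \<otimes>\<^bsub>G\<^esub> h) = \<Phi> g \<circ> \<Phi> h"
    and inj: "inj_on W (carrier G)"
    and W: "\<And>g. g \<in> carrier G \<Longrightarrow> set (W g) \<subseteq> {1, 2, 3, 4} \<and> distinct_adj (W g)
      \<and> \<Phi> g = foldr flip (W g)"
    using ex_word_action[OF assms] by metis
  have G: "group G" using assms(1) by (simp add: free_group_def)
  \<comment> \<open>Five labels, with 0 for padding, times two bits.\<close>
  define \<Sigma> :: "nat set" where "\<Sigma> = {..<10}"
  define X where "X = topspace (full_shift \<Sigma>)"
  define \<phi> where "\<phi> g = restrict (\<Phi> g) X" for g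
  have \<phi>_flip: "\<phi> g = restrict (foldr flip (W g)) X" if "g \<in> carrier G" for g
    using W[OF that] by (simp add: \<phi>_def)
  have in_X: "foldr flip w x \<in> X" if "x \<in> X" for w x
    using that foldr_flip_in_alphabet by (simp add: X_def \<Sigma>_def)
  have word: "distinct_adj (W g)" "0 \<notin> set (W g)" "set (W g) \<subseteq> {..<5}" if "g \<in> carrier G" for g
    using W[OF that] by auto
  have probe_X: "probe (W g) d \<in> X" if "g \<in> carrier G" "d < 2" for g d
    using probe_in_alphabet[OF word(3)[OF that(1)] that(2)] by (simp add: X_def \<Sigma>_def topspace_full_shift)
  have Aut: "\<phi> g \<in> carrier (Aut_shift \<Sigma>)" if "g \<in> carrier G" for g
    using foldr_flip_in_Aut_shift \<phi>_flip[OF that] by (simp add: X_def \<Sigma>_def)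
  have Bij: "\<phi> g \<in> Bij X" if "g \<in> carrier G" for g
    using Aut[OF that] by (simp add: Aut_shift_def X_def)
  have comp: "\<phi> (g \<otimes>\<^bsub>G\<^esub> h) = compose X (\<phi> g) (\<phi> h)" if gh: "g \<in> carrier G" "h \<in> carrier G" for g h
  proof
    show "\<phi> (g \<otimes>\<^bsub>G\<^esub> h) x = compose X (\<phi> g) (\<phi> h) x" for x
      using mult[OF gh] W[OF gh(2)] in_X by (simp add: \<phi>_def compose_def)
  qed
  have hom: "\<phi> \<in> hom G (Aut_shift \<Sigma>)"
    by (rule homI) (simp_all add: Aut comp Bij, simp add: Aut_shift_def BijGroup_def Bij comp X_def[symmetric])
  have action: "group_action G X \<phi>"
  proof -
    have "\<phi> \<in> hom G (BijGroup X)"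
      by (rule homI) (simp_all add: BijGroup_def Bij comp)
    then show ?thesis
      using G group_BijGroup
      by (simp add: group_action_def group_hom_def group_hom_axioms_def)
  qed
  have self: "\<phi> g (probe (W g) d) 0 mod 2 = d" if "g \<in> carrier G" "d < 2" for g d
    using \<phi>_flip that probe_X foldr_flip_probe_self word by simp
  have other: "\<phi> h (probe (W g) d) 0 mod 2 = 0"
    if "g \<in> carrier G" "h \<in> carrier G" "d < 2" "length (W h) \<le> length (W g)" "W h \<noteq> W g" for g h d
    using \<phi>_flip that probe_X foldr_flip_probe_other by simp
  have minus_1: "\<phi> h (probe (W g) d) (-1) mod 2 = 0"
    if "g \<in> carrier G" "h \<in> carrier G" "d < 2" "length (W h) \<le> length (W g)" for g h d
    using \<phi>_flip that probe_X foldr_flip_probe_minus_1 by simp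
  have label: "\<phi> h (probe (W g) d) i div 2 = probe (W g) 0 i div 2"
    if "g \<in> carrier G" "h \<in> carrier G" "d < 2" for g h d i
    using \<phi>_flip that probe_X foldr_flip_probe_div by simp
  have longest: "\<exists>g \<in> F. \<forall>h \<in> F - {g}. length (W h) \<le> length (W g) \<and> W h \<noteq> W g"
    if "finite F" "F \<noteq> {}" "F \<subseteq> carrier G" for F
    using ex_longest that inj_on_subset[OF inj that(3)] by blast
  have inj_\<phi>: "inj_on \<phi> (carrier G)"
  proof (rule inj_onI, rule ccontr)
    fix g h assume gh: "g \<in> carrier G" "h \<in> carrier G" "\<phi> g = \<phi> h" "g \<noteq> h"
    \<comment> \<open>The longer word plays \<open>k\<close>; its probe separates the two maps at
      cell 0.\<close>
    obtain k l where "k \<in> {g, h}" "l \<in> {g, h} - {k}" "length (W l) \<le> length (W k)" "W l \<noteq> W k"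
      using longest[of "{g, h}"] gh by blast
    then show False using self[of k 1] other[of k l 1] gh by auto
  qed
  have P: "property_P \<Sigma> (\<phi> ` carrier G)"
    unfolding property_P_def
  proof (intro allI impI, elim conjE)
    fix F' assume F': "finite F'" "F' \<noteq> {}" "F' \<subseteq> \<phi> ` carrier G"
    then obtain F where F: "finite F" "F \<subseteq> carrier G" "F' = \<phi> ` F"
      by (meson finite_subset_image)
    obtain g where g: "g \<in> F" and
      max: "\<And>h. h \<in> F - {g} \<Longrightarrow> length (W h) \<le> length (W g) \<and> W h \<noteq> W g"
      using longest[OF F(1) _ F(2)] F'(2) F(3) by blast
    have gG: "g \<in> carrier G" using g F by blast
    \<comment> \<open>Here \<open>?u\<close> spells the word with bits 0, and \<open>?v\<close> is
      padding of the same length.\<close>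
    let ?u = "map ((*) 2) (W g)" and ?v = "replicate (length (W g)) (0 :: nat)"
    have lists: "?u \<in> lists \<Sigma>" "?v \<in> lists \<Sigma>" using word(3)[OF gG] by (fastforce simp: \<Sigma>_def)+
    have letters: "0 \<in> \<Sigma>" "1 \<in> \<Sigma>" by (auto simp: \<Sigma>_def)
    have neq: "restrict (\<phi> g (probe (W g) 0)) {-1, 0} \<noteq> restrict (\<phi> g (probe (W g) 1)) {-1, 0}"
    proof
      assume "restrict (\<phi> g (probe (W g) 0)) {-1, 0} = restrict (\<phi> g (probe (W g) 1)) {-1, 0}"
      then have "restrict (\<phi> g (probe (W g) 0)) {-1, 0} 0 = restrict (\<phi> g (probe (W g) 1)) {-1, 0} 0"
        by simp
      then show False using self[OF gG, of 0] self[OF gG, of 1] by simp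
    qed
    have eq: "restrict (\<phi> h (probe (W g) 0)) {-1, 0} = restrict (\<phi> h (probe (W g) 1)) {-1, 0}"
      if h: "h \<in> F - {g}" for h
    proof (rule restrict_ext)
      fix i :: int assume i: "i \<in> {-1, 0}"
      have hG: "h \<in> carrier G" using h F by blast
      have "\<phi> h (probe (W g) 0) i mod 2 = \<phi> h (probe (W g) 1) i mod 2"
        using i max[OF h] other[OF gG hG] minus_1[OF gG hG] by auto
      \<comment> \<open>A symbol is determined by its label and its bit.\<close>
      moreover have "\<phi> h (probe (W g) 0) i div 2 = \<phi> h (probe (W g) 1) i div 2"
        using label[OF gG hG] by simp
      ultimately show "\<phi> h (probe (W g) 0) i = \<phi> h (probe (W g) 1) i"
        by (metis div_mult_mod_eq)
    qed
    have others: "\<forall>h \<in> F' - {\<phi> g}. restrict (h (probe (W g) 0)) {-1, 0} = restrict (h (probe (W g) 1)) {-1, 0}"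
      using eq F(3) by blast
    show "\<exists>g \<in> F'. \<exists>u \<in> lists \<Sigma>. \<exists>v \<in> lists \<Sigma>. \<exists>a \<in> \<Sigma>. \<exists>b \<in> \<Sigma>. \<exists>a' \<in> \<Sigma>. \<exists>b' \<in> \<Sigma>.
        length u = length v \<and>
        restrict (g (periodic (u @ [a, b] @ v))) {-1, 0}
          \<noteq> restrict (g (periodic (u @ [a', b'] @ v))) {-1, 0} \<and>
        (\<forall>h \<in> F' - {g}.
          restrict (h (periodic (u @ [a, b] @ v))) {-1, 0}
            = restrict (h (periodic (u @ [a', b'] @ v))) {-1, 0})"
      \<comment> \<open>The central pairs are \<open>[0, 0]\<close> and \<open>[1, 0]\<close>: only
        the bit of cell \<open>length (W g)\<close> changes.\<close>
      unfolding probe_def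
      by (rule bexI[of _ "\<phi> g"], rule bexI[of _ ?u], rule bexI[of _ ?v],
          rule bexI[of _ 0], rule bexI[of _ 0], rule bexI[of _ 1], rule bexI[of _ 0])
        (use neq[unfolded probe_def] others[unfolded probe_def] g F(3) lists letters in \<open>simp_all only: length_map length_replicate, simp_all\<close>)
  qed
  have sys: "G_system G (full_shift \<Sigma>) \<phi>"
    using action homeomorphic_map_foldr_flip \<phi>_flip
    by (auto simp: G_system_def compact_space_full_shift metrizable_space_full_shift
        full_shift_dim_le_0 X_def \<Sigma>_def)
  have uv: "unique_visits G (full_shift \<Sigma>) \<phi>"
    unfolding unique_visits_def
  proof (intro exI conjI allI impI)
    \<comment> \<open>The bit at cell 0 detects the visit: on the probe of a longest word with
      \<open>d = 1\<close>, only that word brings a 1 there.\<close>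
    let ?C = "{x \<in> topspace (full_shift \<Sigma>). x 0 mod 2 = 1}"
    show "openin (full_shift \<Sigma>) ?C" "closedin (full_shift \<Sigma>) ?C"
      by (rule clopenin_finitely_determined[of "{0}"]; simp)+
    fix F assume "finite F \<and> F \<noteq> {} \<and> F \<subseteq> carrier G"
    then have F: "finite F" "F \<noteq> {}" "F \<subseteq> carrier G" by auto
    obtain g where g: "g \<in> F" and
      max: "\<And>h. h \<in> F - {g} \<Longrightarrow> length (W h) \<le> length (W g) \<and> W h \<noteq> W g"
      using longest[OF F] by blast
    have gG: "g \<in> carrier G" using g F by blast
    let ?x = "probe (W g) 1"
    have "?x \<in> X" using probe_X[OF gG] by simp
    moreover have "\<phi> g ?x \<in> X" using \<phi>_flip[OF gG] in_X[OF \<open>?x \<in> X\<close>] \<open>?x \<in> X\<close> by simp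
    moreover have "h = g" if "h \<in> F" "\<phi> h ?x \<in> ?C" for h
      using other[OF gG, of h 1] max[of h] that F by auto
    ultimately show "\<exists>x \<in> topspace (full_shift \<Sigma>). \<exists>!g. g \<in> F \<and> \<phi> g x \<in> ?C"
      using g self[OF gG, of 1] by (intro bexI[of _ ?x] ex1I[of _ g]) (auto simp: X_def)
  qed
  have "finite \<Sigma>" "card \<Sigma> \<ge> 2" by (simp_all add: \<Sigma>_def)
  moreover have "acts_with_property_P G \<Sigma> \<phi>"
    using hom inj_\<phi> P by (simp add: acts_with_property_P_def)
  moreover have "\<not> has_cancellation G (full_shift \<Sigma>) \<phi> A"
    if "comm_group A" "finite (carrier A)" for A :: "nat monoid"
    using unique_visits_not_has_cancellation[OF that _ uv] action by (simp add: X_def)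
  ultimately show ?thesis using sys uv by blast
qed

end
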